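(* Let $n$ be a positive integer such that $p^4\nmid n$ for each prime $p$. Then every ring of order $n$ is a TAF-ring. Moreover, for each prime $p$, the ring $\mathbb{Z}_{p^3}[X]/(X^2,pX)$ is a ring of order $p^4$ which is not a TAF-ring.
   Context: All rings are commutative with identity; $\mathbb{Z}_m$ denotes $\mathbb{Z}/m\mathbb{Z}$, and the order of a finite ring is its cardinality. An ideal $I$ of a ring $R$ is a 2-absorbing ideal (TA-ideal) if whenever $a,b,c\in R$ and $abc\in I$, then $ab\in I$ or $ac\in I$ or $bc\in I$. A TA-factorization of an ideal $I$ is an expression $I=J_1\cdots J_n$ as a product of proper TA-ideals. $R$ is a TAF-ring if every proper ideal of $R$ has a TA-factorization. *)

theory Defs
  imports
    "HOL-Algebra.Ideal_Product"
    "HOL-Algebra.IntRing"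
    "HOL-Algebra.UnivPoly"
begin

definition TA_ideal :: "'a set \<Rightarrow> ('a, 'm) ring_scheme \<Rightarrow> bool" where
  "TA_ideal I R \<longleftrightarrow>
     ideal I R \<and>
     (\<forall>a\<in>carrier R. \<forall>b\<in>carrier R. \<forall>c\<in>carrier R.
        a \<otimes>\<^bsub>R\<^esub> b \<otimes>\<^bsub>R\<^esub> c \<in> I \<longrightarrow>
          a \<otimes>\<^bsub>R\<^esub> b \<in> I \<or> a \<otimes>\<^bsub>R\<^esub> c \<in> I \<or> b \<otimes>\<^bsub>R\<^esub> c \<in> I)"

text \<open>The unit ideal, neutral for the product of ideals, ends the fold.\<close>

definition ideal_list_prod :: "('a, 'm) ring_scheme \<Rightarrow> 'a set list \<Rightarrow> 'a set" where
  "ideal_list_prod R Js = foldr (ideal_prod R) Js (carrier R)"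

definition TA_factorization :: "('a, 'm) ring_scheme \<Rightarrow> 'a set \<Rightarrow> 'a set list \<Rightarrow> bool" where
  "TA_factorization R I Js \<longleftrightarrow>
     Js \<noteq> [] \<and>
     (\<forall>J\<in>set Js. TA_ideal J R \<and> J \<noteq> carrier R) \<and>
     I = ideal_list_prod R Js"

text \<open>\<open>TAF_ring\<close> does not assert that \<open>R\<close> is a commutative ring; this is always
  stated separately, so that \<open>\<not> TAF_ring R\<close> is a statement about factorizations only.\<close>

definition TAF_ring :: "('a, 'm) ring_scheme \<Rightarrow> bool" where
  "TAF_ring R \<longleftrightarrow>
     (\<forall>I. ideal I R \<and> I \<noteq> carrier R \<longrightarrow> (\<exists>Js. TA_factorization R I Js))"

definition UP_X :: "('a, 'm) ring_scheme \<Rightarrow> nat \<Rightarrow> 'a" where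
  "UP_X R = monom (UP R) \<one>\<^bsub>R\<^esub> 1"

text \<open>\<open>\<int>\<^bsub>p^3\<^esub>[X] / (X\<^sup>2, pX)\<close>, where \<open>add_pow\<close> forms the integer multiple \<open>pX\<close>.\<close>

definition example_ring :: "nat \<Rightarrow> (nat \<Rightarrow> int set) set ring" where
  "example_ring p =
     (let R = ZFact (int p ^ 3); P = UP R; X = UP_X R
      in P Quot (genideal P {X [^]\<^bsub>P\<^esub> (2::nat), add_pow P p X}))"

end

theory Submission
  imports
    Defs
    "HOL-Algebra.Multiplicative_Group"
    "HOL-Number_Theory.Cong"
begin

text \<open>
  By induction on the index, only ideals \<open>I\<close> that are not products of two larger proper ideals
  matter. For such \<open>I\<close> the ring \<open>R / I\<close> has no nontrivial idempotents, hence is local with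
  nilpotent maximal ideal \<open>M / I\<close>. If \<open>M\<^sup>2 \<subseteq> I\<close>, then \<open>I\<close> is a TA-ideal. Otherwise there is a
  chain \<open>R \<supset> M \<supset> L \<supset> I\<close> with \<open>M\<^sup>2 \<subseteq> L\<close>, and each step contributes a factor \<open>p\<close> to the
  order of \<open>R\<close>, where \<open>p\<close> is the residue characteristic. Since \<open>p\<^sup>4\<close> does not divide that order,
  the chain cannot be refined or extended; therefore \<open>M L \<subseteq> I\<close>, and then \<open>I = M\<^sup>3\<close>.

  In \<open>\<int>\<^bsub>p^3\<^esub>[X] / (X\<^sup>2, pX)\<close> every TA-ideal contains \<open>p\<^sup>2\<close>, because \<open>p\<^sup>3 = 0\<close>, while the square
  of the maximal ideal \<open>(p, X)\<close> is \<open>(p\<^sup>2)\<close>. The ideal \<open>(X)\<close> does not contain \<open>p\<^sup>2\<close> and is not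
  contained in \<open>(p\<^sup>2)\<close>, so it is not a product of TA-ideals.
\<close>

section \<open>Rings of fourth-power-free order\<close>

text \<open>The powers of \<open>x\<close> are eventually periodic, so an exponent beyond the
  preperiod that is a multiple of the period works.\<close>

lemma (in monoid) finite_imp_idempotent_power:
  assumes "finite (carrier G)" "x \<in> carrier G"
  obtains m :: nat where "m > 0" "x [^] m \<otimes> x [^] m = x [^] m"
proof -
  have "finite (range (\<lambda>n::nat. x [^] n))"
    by (rule finite_subset[OF _ assms(1)]) (use assms in auto)
  then have "\<not> inj (\<lambda>n::nat. x [^] n)"
    using finite_imageD infinite_UNIV_nat by blast
  then obtain i j :: nat where ij: "i < j" "x [^] i = x [^] j"
    unfolding inj_def by (metis linorder_neqE_nat)
  define d where "d = j - i"
  have step: "x [^] (k + d) = x [^] k" if "k \<ge> i" for k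
  proof -
    have "x [^] (k + d) = x [^] (k - i) \<otimes> x [^] j"
      using that ij assms by (simp add: d_def nat_pow_mult)
    also have "\<dots> = x [^] (k - i) \<otimes> x [^] i"
      using ij by simp
    also have "\<dots> = x [^] k"
      using that assms by (simp add: nat_pow_mult)
    finally show ?thesis .
  qed
  have steps: "x [^] (k + t * d) = x [^] k" if "k \<ge> i" for k t
  proof (induction t)
    case (Suc t)
    have "x [^] (k + Suc t * d) = x [^] ((k + t * d) + d)"
      by (simp add: ac_simps)
    then show ?case
      using Suc step[of "k + t * d"] that by simp
  qed simp
  \<comment> \<open>A multiple of the period \<open>d\<close> that is at least \<open>i\<close>; the
    factor \<open>Suc i\<close> keeps it positive even for \<open>i = 0\<close>.\<close>
  define k where "k = Suc i * d"
  have "d > 0" using ij by (simp add: d_def)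
  then have k: "k \<ge> i" "k > 0"
    unfolding k_def by (simp_all add: trans_le_add2)
  have "x [^] k \<otimes> x [^] k = x [^] (k + Suc i * d)"
    using assms by (simp add: nat_pow_mult k_def)
  also have "\<dots> = x [^] k"
    by (rule steps) (rule k)
  finally show thesis using that k by blast
qed

text \<open>In \<open>G / A\<close> every element has \<open>p\<close>-power order, so a nontrivial
  one has order divisible by \<open>p\<close>, and that order divides the index of
  \<open>A\<close>.\<close>

lemma (in comm_group) prime_times_card_subgroup_dvd_order:
  assumes A: "subgroup A G" "A \<noteq> carrier G"
    and p: "Factorial_Ring.prime p"
    and pow: "\<And>x. x \<in> carrier G \<Longrightarrow> x [^] (p ^ N :: nat) \<in> A"
  shows "p * card A dvd order G"
proof -
  interpret A: normal A G
    using A by (simp add: subgroup_imp_normal)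
  interpret Q: group "G Mod A"
    by (rule A.factorgroup_is_group)
  obtain x where x: "x \<in> carrier G" "x \<notin> A"
    using A A.subset by blast
  let ?c = "A #> x"
  have c: "?c \<in> carrier (G Mod A)"
    using x by (auto simp: carrier_FactGroup)
  have "?c [^]\<^bsub>G Mod A\<^esub> (p ^ N) = A #> (x [^] (p ^ N))"
    using A.FactGroup_pow x by simp
  also have "\<dots> = \<one>\<^bsub>G Mod A\<^esub>"
    using pow[OF x(1)] by (simp add: A.rcos_const)
  finally have "Q.ord ?c dvd p ^ N"
    using c Q.pow_eq_id by blast
  moreover have "?c \<noteq> A"
    using x rcos_self[OF x(1) A(1)] by blast
  then have "Q.ord ?c \<noteq> 1"
    using c Q.ord_eq_1 by simp
  ultimately have "p dvd Q.ord ?c"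
    using p by (metis divides_primepow_nat dvd_power neq0_conv power_0)
  moreover have "Q.ord ?c dvd order (G Mod A)"
    by (rule Q.ord_dvd_group_order[OF c])
  moreover have "order (G Mod A) * card A = order G"
    using lagrange[OF A(1)] by (simp add: order_def FactGroup_def)
  ultimately show ?thesis
    by (metis dvd_trans mult_dvd_mono dvd_refl)
qed

lemma (in ring) add_pow_one_power:
  "add_pow R p \<one> [^] (N::nat) = add_pow R (p ^ N :: nat) \<one>"
proof (induction N)
  case (Suc N)
  then show ?case
    by (simp add: add_pow_rdistr add.nat_pow_pow mult.commute)
qed simp

text \<open>In the additive group of \<open>B\<close>, the \<open>p^N\<close>-fold multiple of
  \<open>x\<close> is the product of \<open>x\<close> with the \<open>p^N\<close>-fold multiple of
  \<open>1\<close>, hence lies in \<open>A\<close>.\<close>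

lemma (in ring) prime_times_card_ideal_dvd_card_ideal:
  assumes "ideal A R" "ideal B R" "A \<subset> B"
    and p: "Factorial_Ring.prime p" and N: "add_pow R p \<one> [^] (N::nat) \<in> A"
  shows "p * card A dvd card B"
proof -
  interpret A: ideal A R by fact
  interpret B: ideal B R by fact
  let ?G = "(add_monoid R)\<lparr>carrier := B\<rparr>"
  have "group ?G"
    using add.subgroup_imp_group[OF B.a_subgroup] by simp
  then interpret G: comm_group ?G
    by (rule group.group_comm_groupI) (simp add: B.a_Hcarr a_comm)
  have "p * card A dvd order ?G"
  proof (rule G.prime_times_card_subgroup_dvd_order[where N = N])
    show "subgroup A ?G"
      using add.subgroup_incl[OF A.a_subgroup B.a_subgroup] \<open>A \<subset> B\<close> by auto
    show "A \<noteq> carrier ?G"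
      using \<open>A \<subset> B\<close> by auto
    fix x assume "x \<in> carrier ?G"
    then have x: "x \<in> B" "x \<in> carrier R" by (auto simp: B.a_Hcarr)
    have "add_pow R (p ^ N) x = add_pow R (p ^ N) \<one> \<otimes> x"
      using x by (simp add: add_pow_ldistr)
    also have "\<dots> \<in> A"
      using N x by (simp add: A.I_r_closed add_pow_one_power)
    finally show "x [^]\<^bsub>?G\<^esub> (p ^ N) \<in> A"
      by (simp only: flip: add.nat_pow_consistent)
  qed (rule p)
  then show ?thesis by (simp add: order_def)
qed

text \<open>Each of the four strict inclusions contributes one factor \<open>p\<close>. The
  contrapositive bounds the length of chains of ideals.\<close>

lemma (in ring) chain_imp_prime_fourth_power_dvd_order:
  assumes id: "ideal A R" "ideal B R" "ideal C R" "ideal D R"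
    and chain: "A \<subset> B" "B \<subset> C" "C \<subset> D" "D \<subset> carrier R"
    and p: "Factorial_Ring.prime p" and N: "add_pow R p \<one> [^] (N::nat) \<in> A"
  shows "p ^ 4 dvd order R"
proof -
  note dvd = prime_times_card_ideal_dvd_card_ideal[OF _ _ _ p, of _ _ N]
  have "p * card D dvd order R"
    unfolding order_def by (rule dvd) (use id oneideal chain N in auto)
  moreover have "p * (p * card C) dvd p * card D"
    by (intro mult_dvd_mono dvd) (use id chain N in auto)
  moreover have "p * (p * (p * card B)) dvd p * (p * card C)"
    by (intro mult_dvd_mono dvd) (use id chain N in auto)
  moreover have "p * (p * (p * (p * card A))) dvd p * (p * (p * card B))"
    by (intro mult_dvd_mono dvd) (use id chain N in auto)
  ultimately have "p * (p * (p * (p * card A))) dvd order R"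
    using dvd_trans by blast
  moreover have "p * (p * (p * (p * card A))) = p ^ 4 * card A"
    by (simp add: numeral_eq_Suc)
  ultimately show ?thesis
    by (metis dvd_mult_left)
qed

section \<open>Covering pairs of ideals\<close>

text \<open>The covering relation in the lattice of ideals: \<open>B / L\<close> is a simple module.
  For \<open>B = carrier R\<close> it makes \<open>L\<close> a maximal ideal.\<close>

definition ideal_covered :: "('a, 'm) ring_scheme \<Rightarrow> 'a set \<Rightarrow> 'a set \<Rightarrow> bool" where
  "ideal_covered R L B \<longleftrightarrow> ideal L R \<and> ideal B R \<and> L \<subset> B \<and>
     (\<forall>K. ideal K R \<and> L \<subseteq> K \<and> K \<subset> B \<longrightarrow> K = L)"

lemma (in ring) ex_ideal_covered:
  assumes fin: "finite (carrier R)" and "ideal A R" "ideal B R" "A \<subset> B"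
  shows "\<exists>L. A \<subseteq> L \<and> ideal_covered R L B"
proof -
  let ?S = "{L. ideal L R \<and> L \<subset> B}"
  have "?S \<subseteq> Pow (carrier R)"
    by (auto dest: ideal.Icarr)
  then have "finite ?S"
    using fin finite_subset by blast
  moreover have "A \<in> ?S"
    using assms by simp
  ultimately obtain L where "L \<in> ?S" "A \<subseteq> L" "\<forall>K\<in>?S. L \<subseteq> K \<longrightarrow> K = L"
    using finite_has_maximal2[of ?S A] by (metis (no_types, lifting))
  then show ?thesis
    using \<open>ideal B R\<close> unfolding ideal_covered_def by blast
qed

text \<open>A stand-in for Nakayama's lemma: the set of all \<open>l \<in> L\<close> with \<open>x l \<in> L'\<close> is an ideal
  between \<open>L'\<close> and \<open>L\<close>, and it cannot be \<open>L'\<close>, since then \<open>x\<close> would act injectively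
  on \<open>L / L'\<close>, where \<open>x\<^sup>m\<close> is zero.\<close>

lemma (in cring) nilpotent_mult_covered_ideal:
  assumes cover: "ideal_covered R L' L"
    and x: "x \<in> carrier R" "x [^] (m::nat) \<in> L'" and l: "l \<in> L"
  shows "x \<otimes> l \<in> L'"
proof -
  interpret L': ideal L' R using cover by (simp add: ideal_covered_def)
  interpret L: ideal L R using cover by (simp add: ideal_covered_def)
  have "L' \<subset> L" using cover by (simp add: ideal_covered_def)
  define K where "K = {l \<in> L. x \<otimes> l \<in> L'}"
  have "ideal K R"
  proof (rule idealI)
    show "subgroup K (add_monoid R)"
    proof (rule add.subgroupI)
      show "K \<noteq> {}"
        using x by (auto simp: K_def intro!: exI[of _ \<zero>])
    qed (use x in \<open>auto simp: K_def L.a_Hcarr r_distr r_minus simp flip: a_inv_def\<close>)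
  next
    fix a c assume ac: "a \<in> K" "c \<in> carrier R"
    then have a: "a \<in> L" "a \<in> carrier R" "x \<otimes> a \<in> L'"
      by (auto simp: K_def L.a_Hcarr)
    have "x \<otimes> (c \<otimes> a) = c \<otimes> (x \<otimes> a)"
      using a ac x by (simp add: m_lcomm)
    then show "c \<otimes> a \<in> K"
      using a ac by (simp add: K_def L.I_l_closed L'.I_l_closed)
    then show "a \<otimes> c \<in> K"
      using a ac by (simp add: m_comm)
  qed (rule ring_axioms)
  moreover have "L' \<subseteq> K"
    unfolding K_def using \<open>L' \<subset> L\<close> x(1) L'.I_l_closed by blast
  moreover have "K \<subseteq> L"
    by (auto simp: K_def)
  moreover have "K \<noteq> L'"
  proof
    assume "K = L'"
    then have inj: "l \<in> L'" if "l \<in> L" "x \<otimes> l \<in> L'" for l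
      using that by (auto simp: K_def)
    have "l \<in> L'" if "l \<in> L" "x [^] (m::nat) \<otimes> l \<in> L'" for l m
      using that
    proof (induction m arbitrary: l)
      case 0
      then show ?case by (simp add: L.a_Hcarr)
    next
      case (Suc m)
      have "x \<otimes> l \<in> L'"
        by (rule Suc.IH) (use Suc.prems x in \<open>simp_all add: L.I_l_closed L.a_Hcarr m_assoc\<close>)
      then show ?case
        using inj Suc.prems by blast
    qed
    then have "L \<subseteq> L'"
      using x L'.I_r_closed L.a_Hcarr by blast
    then show False
      using \<open>L' \<subset> L\<close> by blast
  qed
  ultimately have "K = L"
    using cover unfolding ideal_covered_def by blast
  then show ?thesis
    using l by (auto simp: K_def)
qed

section \<open>Prime ideals and criteria for TA-ideals\<close>

lemma ideal_prod_subset_ideal: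
  assumes "ideal C R" "\<And>a b. a \<in> A \<Longrightarrow> b \<in> B \<Longrightarrow> a \<otimes>\<^bsub>R\<^esub> b \<in> C"
  shows "ideal_prod R A B \<subseteq> C"
proof
  interpret ideal C R by fact
  fix s assume "s \<in> ideal_prod R A B"
  then show "s \<in> C"
    by induction (auto intro: assms)
qed

text \<open>Split a prime factor off \<open>n\<close>: since \<open>M\<close> is prime, it contains
  the multiple of \<open>1\<close> by that factor or by the smaller cofactor. This provides the
  residue characteristic.\<close>

lemma (in cring) ex_prime_in_primeideal:
  assumes "primeideal M R" "n > 0" "add_pow R (n::nat) \<one> \<in> M"
  shows "\<exists>p::nat. Factorial_Ring.prime p \<and> add_pow R p \<one> \<in> M"
  using assms(2,3)
proof (induction n rule: less_induct)
  case (less n)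
  interpret M: primeideal M R by fact
  have "n \<noteq> 1"
    using less.prems M.I_notcarr M.one_imp_carrier by auto
  then obtain p where p: "Factorial_Ring.prime p" "p dvd n"
    using prime_factor_nat by blast
  then obtain m where m: "n = p * m" by auto
  have "add_pow R p \<one> \<otimes> add_pow R m \<one> = add_pow R n \<one>"
    by (simp add: m add_pow_ldistr add.nat_pow_pow mult.commute)
  then have "add_pow R p \<one> \<in> M \<or> add_pow R m \<one> \<in> M"
    using M.I_prime less.prems by simp
  moreover have "m < n" "m > 0"
    using less.prems m prime_gt_1_nat[OF p(1)] by auto
  ultimately show ?case
    using less.IH p by blast
qed

text \<open>If \<open>a b c\<close> lies in \<open>M\<close>, then \<open>a b\<close> does, or
  \<open>c\<close> does and with it \<open>a c\<close>.\<close>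

lemma (in cring) primeideal_imp_TA_ideal:
  assumes "primeideal M R"
  shows "TA_ideal M R"
proof -
  interpret primeideal M R by fact
  show ?thesis
    unfolding TA_ideal_def using I_prime[of "_ \<otimes> _"] I_l_closed is_ideal
    by (meson m_closed)
qed

text \<open>Elements outside \<open>M\<close> are units modulo \<open>I\<close> and can be cancelled
  from \<open>a b c\<close>; if neither \<open>a\<close> nor \<open>b\<close> can be cancelled this
  way, both lie in \<open>M\<close> and \<open>square\<close> applies.\<close>

lemma (in cring) TA_idealI_square_subset:
  assumes "ideal I R"
    and unit: "\<And>a. a \<in> carrier R \<Longrightarrow> a \<notin> M \<Longrightarrow> \<exists>u\<in>carrier R. \<one> \<ominus> u \<otimes> a \<in> I"
    and square: "\<And>a b. a \<in> M \<Longrightarrow> b \<in> M \<Longrightarrow> a \<otimes> b \<in> I"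
  shows "TA_ideal I R"
proof -
  interpret ideal I R by fact
  have cancel: "b \<in> I" if "a \<in> carrier R" "b \<in> carrier R" "a \<notin> M" "a \<otimes> b \<in> I" for a b
  proof -
    obtain u where u: "u \<in> carrier R" "\<one> \<ominus> u \<otimes> a \<in> I"
      using unit \<open>a \<in> carrier R\<close> \<open>a \<notin> M\<close> by blast
    have "b = (\<one> \<ominus> u \<otimes> a) \<otimes> b \<oplus> u \<otimes> (a \<otimes> b)"
      using that u by algebra
    also have "\<dots> \<in> I"
      using that u by (simp add: I_r_closed I_l_closed)
    finally show ?thesis .
  qed
  have "a \<otimes> b \<in> I \<or> a \<otimes> c \<in> I \<or> b \<otimes> c \<in> I"
    if "a \<in> carrier R" "b \<in> carrier R" "c \<in> carrier R" "a \<otimes> b \<otimes> c \<in> I" for a b c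
  proof -
    have "a \<otimes> (b \<otimes> c) \<in> I" "b \<otimes> (a \<otimes> c) \<in> I"
      using that by (simp_all add: m_ac)
    then show ?thesis
      using cancel[of a "b \<otimes> c"] cancel[of b "a \<otimes> c"] square[of a b] that by auto
  qed
  then show ?thesis
    unfolding TA_ideal_def using is_ideal by blast
qed

section \<open>Splitting an ideal along complementary idempotents\<close>

lemma (in ring) mem_ideal_sum_cgenideal_iff:
  "a \<in> I <+>\<^bsub>R\<^esub> PIdl f \<longleftrightarrow> (\<exists>i\<in>I. \<exists>r\<in>carrier R. a = i \<oplus> r \<otimes> f)"
  by (auto simp: set_add_def' cgenideal_def)

lemma (in ring) subset_ideal_sum_cgenideal:
  assumes "ideal I R" "f \<in> carrier R"
  shows "I \<subseteq> I <+>\<^bsub>R\<^esub> PIdl f"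
proof
  interpret ideal I R by fact
  fix i assume "i \<in> I"
  then show "i \<in> I <+>\<^bsub>R\<^esub> PIdl f"
    unfolding mem_ideal_sum_cgenideal_iff using assms(2)
    by (intro bexI[of _ i] bexI[of _ \<zero>]) simp_all
qed

lemma (in ring) generator_in_ideal_sum_cgenideal:
  assumes "ideal I R" "f \<in> carrier R"
  shows "f \<in> I <+>\<^bsub>R\<^esub> PIdl f"
proof -
  interpret ideal I R by fact
  show ?thesis
    unfolding mem_ideal_sum_cgenideal_iff using assms(2)
    by (intro bexI[of _ \<zero>] bexI[of _ \<one>]) simp_all
qed

text \<open>Multiplying an equation \<open>1 = i + r f\<close> by \<open>g\<close> would give
  \<open>g = i g\<close>, an element of \<open>I\<close>.\<close>

lemma (in cring) ideal_sum_cgenideal_ne_carrier: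
  assumes "ideal I R" "f \<in> carrier R" "g \<in> carrier R" "f \<otimes> g = \<zero>" "g \<notin> I"
  shows "I <+>\<^bsub>R\<^esub> PIdl f \<noteq> carrier R"
proof
  interpret ideal I R by fact
  assume "I <+>\<^bsub>R\<^esub> PIdl f = carrier R"
  then have "\<one> \<in> I <+>\<^bsub>R\<^esub> PIdl f"
    by simp
  then obtain i r where ir: "i \<in> I" "r \<in> carrier R" "\<one> = i \<oplus> r \<otimes> f"
    unfolding mem_ideal_sum_cgenideal_iff by blast
  have "g = (i \<oplus> r \<otimes> f) \<otimes> g"
    using assms(3) by (simp flip: ir(3))
  also have "\<dots> = i \<otimes> g \<oplus> r \<otimes> (f \<otimes> g)"
    using ir(1,2) assms(2,3) by (simp add: l_distr m_assoc)
  also have "\<dots> = i \<otimes> g"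
    using ir assms by simp
  also have "\<dots> \<in> I"
    using ir assms by (simp add: I_r_closed)
  finally show False
    using assms by blast
qed

text \<open>In a product of elements of the two sums, the term with \<open>f g\<close> vanishes and
  all others lie in \<open>I\<close>; conversely \<open>x = f x + x g\<close>. Idempotence of
  \<open>f\<close> and \<open>g\<close> follows from the two equations.\<close>

lemma (in cring) ideal_eq_prod_orthogonal_idempotents:
  assumes "ideal I R" "f \<in> carrier R" "g \<in> carrier R" "f \<otimes> g = \<zero>" "f \<oplus> g = \<one>"
  shows "I = (I <+>\<^bsub>R\<^esub> PIdl f) \<cdot> (I <+>\<^bsub>R\<^esub> PIdl g)"
proof
  interpret ideal I R by fact
  show "(I <+>\<^bsub>R\<^esub> PIdl f) \<cdot> (I <+>\<^bsub>R\<^esub> PIdl g) \<subseteq> I"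
  proof (rule ideal_prod_subset_ideal)
    fix a b assume "a \<in> I <+>\<^bsub>R\<^esub> PIdl f" "b \<in> I <+>\<^bsub>R\<^esub> PIdl g"
    then obtain i r j s where *: "i \<in> I" "r \<in> carrier R" "a = i \<oplus> r \<otimes> f"
        "j \<in> I" "s \<in> carrier R" "b = j \<oplus> s \<otimes> g"
      by (auto simp: mem_ideal_sum_cgenideal_iff)
    then have "i \<in> carrier R" "j \<in> carrier R" by auto
    then have "a \<otimes> b = i \<otimes> b \<oplus> (r \<otimes> f) \<otimes> j \<oplus> (r \<otimes> s) \<otimes> (f \<otimes> g)"
      using * assms(2,3) by (simp add: l_distr r_distr m_ac a_ac)
    also have "\<dots> \<in> I"
      using * assms(2-4) by (simp add: I_r_closed I_l_closed)
    finally show "a \<otimes> b \<in> I" .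
  qed (rule is_ideal)
  show "I \<subseteq> (I <+>\<^bsub>R\<^esub> PIdl f) \<cdot> (I <+>\<^bsub>R\<^esub> PIdl g)"
  proof
    fix x assume x: "x \<in> I"
    have "x = x \<otimes> (f \<oplus> g)"
      using x assms by simp
    also have "\<dots> = f \<otimes> x \<oplus> x \<otimes> g"
      using x assms(2,3) by (simp add: r_distr m_comm)
    also have "\<dots> \<in> (I <+>\<^bsub>R\<^esub> PIdl f) \<cdot> (I <+>\<^bsub>R\<^esub> PIdl g)"
      using x assms(1-3)
      by (intro ideal_prod.sum ideal_prod.prod generator_in_ideal_sum_cgenideal
          subsetD[OF subset_ideal_sum_cgenideal])
    finally show "x \<in> (I <+>\<^bsub>R\<^esub> PIdl f) \<cdot> (I <+>\<^bsub>R\<^esub> PIdl g)" .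
  qed
qed

section \<open>Concatenating TA-factorizations\<close>

lemma (in ring) ideal_list_prod_is_ideal:
  assumes "\<And>J. J \<in> set Js \<Longrightarrow> ideal J R"
  shows "ideal (ideal_list_prod R Js) R"
  using assms
  by (induction Js) (auto simp: ideal_list_prod_def oneideal ideal_prod_is_ideal)

lemma (in cring) ideal_list_prod_append:
  assumes "\<And>J. J \<in> set Js \<union> set Ks \<Longrightarrow> ideal J R"
  shows "ideal_list_prod R (Js @ Ks) = ideal_list_prod R Js \<cdot> ideal_list_prod R Ks"
  using assms
proof (induction Js)
  case Nil
  then have "ideal (ideal_list_prod R Ks) R"
    by (intro ideal_list_prod_is_ideal) auto
  then show ?case
    using ideal_prod_one[of "ideal_list_prod R Ks"] ideal_prod_commute[OF oneideal]
    by (simp add: ideal_list_prod_def)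
next
  case (Cons J Js)
  have "ideal J R" "ideal (ideal_list_prod R Js) R" "ideal (ideal_list_prod R Ks) R"
    using Cons.prems by (auto intro!: ideal_list_prod_is_ideal)
  then show ?case
    using Cons ideal_prod_assoc by (simp add: ideal_list_prod_def)
qed

lemma (in cring) TA_factorization_prod:
  assumes "TA_factorization R A Js" "TA_factorization R B Ks"
  shows "TA_factorization R (A \<cdot> B) (Js @ Ks)"
proof -
  have "ideal J R" if "J \<in> set Js \<union> set Ks" for J
    using assms that by (auto simp: TA_factorization_def TA_ideal_def)
  then show ?thesis
    using assms ideal_list_prod_append by (auto simp: TA_factorization_def)
qed

section \<open>Ideals that are not products of two larger proper ideals\<close>

text \<open>An idempotent \<open>e\<close> of \<open>R\<close> with neither \<open>e\<close> nor
  \<open>1 - e\<close> in \<open>I\<close> would split \<open>I\<close>. Every element has an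
  idempotent power, which therefore lies in \<open>I\<close> or is congruent to \<open>1\<close>
  modulo \<open>I\<close>; these two cases separate \<open>M\<close> from its complement.\<close>

lemma (in cring) indecomposable_ideal_imp_local:
  assumes fin: "finite (carrier R)" and I: "ideal I R" "I \<noteq> carrier R"
    and indec: "\<And>A B. ideal A R \<Longrightarrow> ideal B R \<Longrightarrow> I \<subset> A \<Longrightarrow> I \<subset> B \<Longrightarrow>
      A \<noteq> carrier R \<Longrightarrow> B \<noteq> carrier R \<Longrightarrow> I \<noteq> A \<cdot> B"
  obtains M where "primeideal M R" "I \<subseteq> M"
    "\<And>a. a \<in> M \<Longrightarrow> \<exists>m::nat. a [^] m \<in> I"
    "\<And>a. a \<in> carrier R \<Longrightarrow> a \<notin> M \<Longrightarrow> \<exists>u\<in>carrier R. \<one> \<ominus> u \<otimes> a \<in> I"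
proof -
  interpret I: ideal I R by fact
  have "I \<subset> carrier R"
    using I I.a_subset by blast
  then obtain M where M: "ideal_covered R M (carrier R)" "I \<subseteq> M"
    using ex_ideal_covered[OF fin I(1) oneideal] by blast
  have "maximalideal M R"
    using M(1) unfolding ideal_covered_def by (intro maximalidealI) blast+
  then have prime: "primeideal M R"
    by (rule maximalideal_prime)
  interpret M: primeideal M R by (rule prime)
  have one: "\<one> \<notin> M"
    using M.I_notcarr M.one_imp_carrier by auto
  have idem: "e \<in> I \<or> \<one> \<ominus> e \<in> I" if e: "e \<in> carrier R" "e \<otimes> e = e" for e
  proof (rule ccontr)
    assume not: "\<not> (e \<in> I \<or> \<one> \<ominus> e \<in> I)"
    define f where "f = \<one> \<ominus> e"
    have f: "f \<in> carrier R" "e \<otimes> f = \<zero>" "f \<otimes> e = \<zero>" "e \<oplus> f = \<one>" "e \<notin> I" "f \<notin> I"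
      using e not unfolding f_def by (simp_all add: minus_eq r_distr l_distr r_minus l_minus r_neg a_lcomm[of e \<one>])
    have sub: "I \<subset> I <+>\<^bsub>R\<^esub> PIdl g" if "g \<in> carrier R" "g \<notin> I" for g
      using subset_ideal_sum_cgenideal[OF I(1) that(1)]
        generator_in_ideal_sum_cgenideal[OF I(1) that(1)] that(2) by blast
    have "I \<noteq> (I <+>\<^bsub>R\<^esub> PIdl e) \<cdot> (I <+>\<^bsub>R\<^esub> PIdl f)"
      using e f I ideal_sum_cgenideal_ne_carrier[of I e f] ideal_sum_cgenideal_ne_carrier[of I f e]
      by (intro indec sub add_ideals cgenideal_ideal) auto
    then show False
      using ideal_eq_prod_orthogonal_idempotents[of I e f] I e f by blast
  qed
  have power: "\<exists>m>0::nat. a [^] m \<in> I \<or> \<one> \<ominus> a [^] m \<in> I" if a: "a \<in> carrier R" for a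
  proof -
    obtain m :: nat where "m > 0" "a [^] m \<otimes> a [^] m = a [^] m"
      by (rule finite_imp_idempotent_power[OF fin a])
    then show ?thesis
      using idem[of "a [^] m"] a by auto
  qed
  show thesis
  proof (rule that[OF prime M(2)])
    fix a assume a: "a \<in> M"
    obtain m :: nat where m: "m > 0" "a [^] m \<in> I \<or> \<one> \<ominus> a [^] m \<in> I"
      using power[OF M.Icarr[OF a]] by blast
    have am: "a [^] m \<in> M"
      using a m(1) by (cases m) (simp_all add: M.I_l_closed)
    have "\<one> \<ominus> a [^] m \<notin> I"
    proof
      assume "\<one> \<ominus> a [^] m \<in> I"
      then have "(\<one> \<ominus> a [^] m) \<oplus> a [^] m \<in> M"
        using am M(2) by blast
      moreover have "(\<one> \<ominus> a [^] m) \<oplus> a [^] m = \<one>"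
        using am by (simp add: minus_eq a_assoc l_neg)
      ultimately show False using one by simp
    qed
    then show "\<exists>m::nat. a [^] m \<in> I" using m by blast
  next
    fix a assume a: "a \<in> carrier R" "a \<notin> M"
    then obtain m :: nat where m: "m > 0" "a [^] m \<in> I \<or> \<one> \<ominus> a [^] m \<in> I"
      using power by blast
    have "a [^] k \<notin> M" for k :: nat
      using a one M.I_prime[of "a [^] _" a] by (induction k) auto
    then have "\<one> \<ominus> a [^] m \<in> I"
      using m M(2) by blast
    moreover obtain k where "m = Suc k"
      using m(1) gr0_conv_Suc by blast
    \<comment> \<open>Since \<open>m = Suc k\<close>, the power \<open>a^k\<close> is an inverse of
      \<open>a\<close> modulo \<open>I\<close>.\<close>
    ultimately show "\<exists>u\<in>carrier R. \<one> \<ominus> u \<otimes> a \<in> I"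
      using a by (intro bexI[of _ "a [^] k"]) auto
  qed
qed

lemma (in cring) indecomposable_ideal_imp_TA_factorization:
  assumes fin: "finite (carrier R)"
    and order: "\<And>p. Factorial_Ring.prime p \<Longrightarrow> \<not> p ^ 4 dvd order R"
    and I: "ideal I R" "I \<noteq> carrier R"
    and indec: "\<And>A B. ideal A R \<Longrightarrow> ideal B R \<Longrightarrow> I \<subset> A \<Longrightarrow> I \<subset> B \<Longrightarrow>
      A \<noteq> carrier R \<Longrightarrow> B \<noteq> carrier R \<Longrightarrow> I \<noteq> A \<cdot> B"
  shows "\<exists>Js. TA_factorization R I Js"
proof -
  interpret I: ideal I R by fact
  obtain M where prime: "primeideal M R" and "I \<subseteq> M"
    and nil: "\<And>a. a \<in> M \<Longrightarrow> \<exists>m::nat. a [^] m \<in> I"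
    and unit: "\<And>a. a \<in> carrier R \<Longrightarrow> a \<notin> M \<Longrightarrow> \<exists>u\<in>carrier R. \<one> \<ominus> u \<otimes> a \<in> I"
    using indecomposable_ideal_imp_local[OF fin I indec] by blast
  interpret M: primeideal M R by (rule prime)
  have M_sub: "M \<subset> carrier R"
    using M.I_notcarr M.a_subset by blast
  show ?thesis
  proof (cases "\<forall>a\<in>M. \<forall>b\<in>M. a \<otimes> b \<in> I")
    case True
    then have "TA_ideal I R"
      using I unit by (intro TA_idealI_square_subset[of I M]) auto
    then have "TA_factorization R I [I]"
      using I ideal_prod_one by (simp add: TA_factorization_def ideal_list_prod_def)
    then show ?thesis by blast
  next
    case False
    then obtain x y where xy: "x \<in> M" "y \<in> M" "x \<otimes> y \<notin> I" by blast
    then have "x \<otimes> y \<in> M"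
      by (simp add: M.I_l_closed)
    then have "I \<subset> M"
      using \<open>I \<subseteq> M\<close> xy by blast
    \<comment> \<open>The order of the additive group annihilates \<open>1\<close>, so some prime
      multiple of \<open>1\<close> lies in \<open>M\<close>.\<close>
    have "add_pow R (order R) \<one> = \<zero>"
      using add.pow_order_eq_1[of \<one>] by (simp add: order_def)
    moreover have "order R > 0"
      using fin by (auto simp: order_def card_gt_0_iff)
    ultimately obtain p :: nat where p: "Factorial_Ring.prime p" "add_pow R p \<one> \<in> M"
      using ex_prime_in_primeideal[OF prime, of "order R"] by auto
    \<comment> \<open>Forbids four strict inclusions ending at \<open>R\<close> once the smallest
      ideal contains a power of \<open>p\<close>.\<close>
    note no_chain = chain_imp_prime_fourth_power_dvd_order[OF _ _ _ _ _ _ _ _ p(1)]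
    obtain N :: nat where N: "add_pow R p \<one> [^] N \<in> I"
      using nil p by blast
    obtain L where L_cover: "ideal_covered R L M" and "I \<subseteq> L"
      using ex_ideal_covered[OF fin I(1) M.is_ideal \<open>I \<subset> M\<close>] by blast
    then have L: "ideal L R" "L \<subset> M"
      by (simp_all add: ideal_covered_def)
    \<comment> \<open>The element \<open>a\<close> is nilpotent modulo \<open>I\<close>, hence
      modulo \<open>L\<close>, and therefore multiplies \<open>M\<close> into \<open>L\<close>,
      which \<open>M\<close> covers.\<close>
    have MM: "a \<otimes> b \<in> L" if "a \<in> M" "b \<in> M" for a b
      using nilpotent_mult_covered_ideal[OF L_cover] nil[OF that(1)] that \<open>I \<subseteq> L\<close> M.Icarr
      by blast
    then have "x \<otimes> y \<in> L"
      using xy by blast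
    then have "I \<subset> L"
      using \<open>I \<subseteq> L\<close> xy by blast
    obtain L' where L'_cover: "ideal_covered R L' L" and "I \<subseteq> L'"
      using ex_ideal_covered[OF fin I(1) L(1) \<open>I \<subset> L\<close>] by blast
    then have L': "ideal L' R" "L' \<subset> L"
      by (simp_all add: ideal_covered_def)
    \<comment> \<open>Otherwise \<open>I\<close>, \<open>L'\<close>, \<open>L\<close>,
      \<open>M\<close>, \<open>R\<close> would be a forbidden chain.\<close>
    have "L' = I"
    proof (rule ccontr)
      assume "L' \<noteq> I"
      then have "I \<subset> L'"
        using \<open>I \<subseteq> L'\<close> by blast
      then have "p ^ 4 dvd order R"
        by (rule no_chain[OF I(1) L'(1) L(1) M.is_ideal _ L'(2) L(2) M_sub N])
      then show False
        using order p(1) by blast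
    qed
    have mult_L: "a \<otimes> b \<in> I" if "a \<in> M" "b \<in> L" for a b
      using nilpotent_mult_covered_ideal[OF L'_cover] nil[OF that(1)] that \<open>L' = I\<close> M.Icarr
      by blast
    let ?T = "M \<cdot> (M \<cdot> M)"
    have id: "ideal (M \<cdot> M) R" "ideal ?T R"
      by (simp_all add: ideal_prod_is_ideal M.is_ideal)
    have "M \<cdot> M \<subseteq> L"
      by (rule ideal_prod_subset_ideal[OF L(1) MM])
    then have "?T \<subseteq> I"
      using mult_L by (intro ideal_prod_subset_ideal[OF I(1)]) blast
    \<comment> \<open>A strict inclusion would give the forbidden chain \<open>M^3\<close>,
      \<open>I\<close>, \<open>L\<close>, \<open>M\<close>, \<open>R\<close>; its smallest member
      contains the cube of \<open>p\<close>, as \<open>no_chain\<close> demands.\<close>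
    have "?T = I"
    proof (rule ccontr)
      assume "?T \<noteq> I"
      then have "?T \<subset> I"
        using \<open>?T \<subseteq> I\<close> by blast
      have "add_pow R p \<one> \<otimes> (add_pow R p \<one> \<otimes> add_pow R p \<one>) \<in> ?T"
        using p(2) by (intro ideal_prod.prod)
      also have "add_pow R p \<one> \<otimes> (add_pow R p \<one> \<otimes> add_pow R p \<one>) = add_pow R p \<one> [^] (3::nat)"
        by (simp add: numeral_3_eq_3 m_assoc)
      finally have "p ^ 4 dvd order R"
        by (rule no_chain[OF id(2) I(1) L(1) M.is_ideal \<open>?T \<subset> I\<close> \<open>I \<subset> L\<close> L(2) M_sub])
      then show False
        using order p(1) by blast
    qed
    then have "TA_factorization R I [M, M, M]"
      using primeideal_imp_TA_ideal[OF prime] M_sub ideal_prod_one[OF M.is_ideal]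
      by (simp add: TA_factorization_def ideal_list_prod_def)
    then show ?thesis by blast
  qed
qed

theorem (in cring) fourth_power_free_order_imp_TAF_ring:
  assumes fin: "finite (carrier R)"
    and order: "\<And>p. Factorial_Ring.prime p \<Longrightarrow> \<not> p ^ 4 dvd order R"
  shows "TAF_ring R"
proof -
  have "\<exists>Js. TA_factorization R I Js" if "ideal I R" "I \<noteq> carrier R" for I
    using that
  proof (induction "card (carrier R) - card I" arbitrary: I rule: less_induct)
    case less
    have IH: "\<exists>Js. TA_factorization R A Js" if "ideal A R" "I \<subset> A" "A \<noteq> carrier R" for A
    proof (rule less.hyps)
      have "A \<subset> carrier R"
        using that by (auto dest: ideal.Icarr)
      then have "card A < card (carrier R)"
        using fin by (rule psubset_card_mono[rotated])
      moreover have "card I < card A"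
        using \<open>A \<subset> carrier R\<close> that fin by (meson finite_subset psubset_card_mono psubset_imp_subset)
      ultimately show "card (carrier R) - card A < card (carrier R) - card I"
        by simp
    qed (use that in auto)
    show ?case
    \<comment> \<open>In the first case the factorizations of \<open>A\<close> and \<open>B\<close>,
      both larger than \<open>I\<close>, are concatenated.\<close>
    proof (cases "\<exists>A B. ideal A R \<and> ideal B R \<and> I \<subset> A \<and> I \<subset> B \<and>
        A \<noteq> carrier R \<and> B \<noteq> carrier R \<and> I = A \<cdot> B")
      case True
      then show ?thesis
        using IH TA_factorization_prod by metis
    next
      case False
      then show ?thesis
        using indecomposable_ideal_imp_TA_factorization[OF fin order less.prems] by blast
    qed
  qed
  then show ?thesis
    unfolding TAF_ring_def by blast
qed

section \<open>The ring of order \<open>p^4\<close>\<close>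

lemma (in ideal) finsum_closed_in_ideal:
  assumes "finite A" "\<And>i. i \<in> A \<Longrightarrow> f i \<in> I"
  shows "(\<Oplus>i\<in>A. f i) \<in> I"
  using assms
proof (induction A)
  case (insert a A)
  then have "f \<in> insert a A \<rightarrow> carrier R"
    by (auto simp: Icarr)
  then show ?case
    using insert by (simp add: Pi_def)
qed simp

lemma (in ideal) rcos_eq_iff:
  assumes "a \<in> carrier R" "b \<in> carrier R"
  shows "I +> a = I +> b \<longleftrightarrow> a \<ominus> b \<in> I"
  using assms quotient_eq_iff_same_a_r_cos[OF is_ideal] by simp

lemma FactRing_carrier: "carrier (R Quot I) = (\<lambda>a. I +>\<^bsub>R\<^esub> a) ` carrier R"
  by (auto simp: FactRing_simps)

text \<open>Both images are in bijection with the classes of one equivalence relation on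
  \<open>A\<close>. This allows cosets to be counted by a complete invariant.\<close>

lemma card_image_eqI:
  assumes "\<And>x y. x \<in> A \<Longrightarrow> y \<in> A \<Longrightarrow> f x = f y \<longleftrightarrow> g x = g y"
  shows "card (f ` A) = card (g ` A)"
proof (rule bij_betw_same_card)
  show "bij_betw (\<lambda>z. g (inv_into A f z)) (f ` A) (g ` A)"
  proof (rule bij_betw_imageI)
    have g: "g (inv_into A f (f x)) = g x" if "x \<in> A" for x
      using assms[of "inv_into A f (f x)" x] that by (simp add: f_inv_into_f inv_into_into)
    show "inj_on (\<lambda>z. g (inv_into A f z)) (f ` A)"
      using assms by (auto simp: inj_on_def g)
    show "(\<lambda>z. g (inv_into A f z)) ` f ` A = g ` A"
      by (auto simp: g image_image)
  qed
qed

lemma card_range_mod: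
  fixes h :: "int \<Rightarrow> 'b"
  assumes "n > 0" "\<And>a b. h a = h b \<longleftrightarrow> a mod int n = b mod int n"
  shows "card (range h) = n"
proof -
  have "range h = h ` {0..<int n}"
  proof -
    have "h a \<in> h ` {0..<int n}" for a
      using assms by (intro image_eqI[of _ _ "a mod int n"]) auto
    then show ?thesis by auto
  qed
  moreover have "inj_on h {0..<int n}"
    by (auto simp: inj_on_def assms(2))
  ultimately show ?thesis
    by (simp add: card_image)
qed

text \<open>The ideal generated by \<open>x\<close> is not a product of TA-ideals: every TA-ideal contains
  \<open>t\<^sup>2\<close>, while products of two or more proper ideals lie in \<open>N\<close>.\<close>

lemma (in cring) not_TAF_ringI:
  assumes x: "x \<in> carrier R" and t: "t \<in> carrier R" "t \<otimes> t \<otimes> t = \<zero>" "t \<otimes> t \<notin> PIdl x"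
    and unit: "\<And>a. a \<in> carrier R \<Longrightarrow> a \<notin> M \<Longrightarrow> \<exists>b\<in>carrier R. b \<otimes> a = \<one>"
    and prod: "\<And>a b. a \<in> M \<Longrightarrow> b \<in> M \<Longrightarrow> a \<otimes> b \<in> N"
    and sum: "\<And>a b. a \<in> N \<Longrightarrow> b \<in> N \<Longrightarrow> a \<oplus> b \<in> N"
    and "x \<notin> N"
  shows "\<not> TAF_ring R"
proof
  assume "TAF_ring R"
  have "PIdl x \<noteq> carrier R"
    using t by auto
  then obtain Js where Js: "TA_factorization R (PIdl x) Js"
    using \<open>TAF_ring R\<close> cgenideal_ideal[OF x] by (auto simp: TAF_ring_def)
  then have id: "ideal J R" "J \<noteq> carrier R" "TA_ideal J R" if "J \<in> set Js" for J
    using that by (auto simp: TA_factorization_def TA_ideal_def)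
  \<comment> \<open>A proper ideal contains no unit, and everything outside \<open>M\<close> is a
    unit.\<close>
  have sub: "J \<subseteq> M" if "J \<in> set Js" for J
  proof
    interpret J: ideal J R by (rule id(1)[OF that])
    fix a assume "a \<in> J"
    show "a \<in> M"
    proof (rule ccontr)
      assume "a \<notin> M"
      then obtain b where "b \<in> carrier R" "b \<otimes> a = \<one>"
        using unit[OF J.Icarr[OF \<open>a \<in> J\<close>]] by blast
      then have "\<one> \<in> J"
        using J.I_l_closed[OF \<open>a \<in> J\<close>, of b] by simp
      then show False
        using J.one_imp_carrier id(2)[OF that] by blast
    qed
  qed
  consider J where "Js = [J]" | J J' Ks where "Js = J # J' # Ks"
    using Js by (metis TA_factorization_def list.exhaust)
  then show False
  proof cases
    \<comment> \<open>A single factor makes \<open>PIdl x\<close> itself a TA-ideal, which the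
      triple \<open>t\<close>, \<open>t\<close>, \<open>t\<close> refutes.\<close>
    case 1
    then have "PIdl x = J"
      using Js id(1) ideal_prod_one by (simp add: TA_factorization_def ideal_list_prod_def)
    then have "TA_ideal (PIdl x) R"
      using 1 id(3) by simp
    moreover have "t \<otimes> t \<otimes> t \<in> PIdl x"
      using t(2) cgenideal_ideal[OF x] by (simp add: additive_subgroup.zero_closed ideal.axioms(1))
    ultimately show False
      using t(1,3) by (auto simp: TA_ideal_def)
  next
    \<comment> \<open>All factors after the first are collected into \<open>?B\<close>, which lies
      in \<open>J'\<close> and hence in \<open>M\<close>.\<close>
    case 2
    let ?B = "J' \<cdot> ideal_list_prod R Ks"
    have "ideal (ideal_list_prod R Ks) R"
      using id(1) 2 by (intro ideal_list_prod_is_ideal) auto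
    then have "?B \<subseteq> J'"
      using ideal_prod_inter id(1) 2 by auto
    then have "?B \<subseteq> M"
      using sub 2 by auto
    have "x \<in> J \<cdot> ?B"
      using Js cgenideal_self[OF x] 2 by (simp add: TA_factorization_def ideal_list_prod_def)
    then have "x \<in> N"
    proof induction
      case (prod i j)
      then show ?case
        \<comment> \<open>\<open>assms(6)\<close> is the hypothesis \<open>prod\<close>, whose name
          the induction case shadows here.\<close>
        using assms(6) sub[of J] 2 \<open>?B \<subseteq> M\<close> by auto
    qed (rule sum)
    with \<open>x \<notin> N\<close> show False ..
  qed
qed

section \<open>Polynomials modulo \<open>X^2\<close> and \<open>J X\<close>\<close>

text \<open>For an ideal \<open>J\<close> this is \<open>(X^2, J X)\<close>. The coefficient form
  shows a coset as a constant term together with a linear coefficient modulo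
  \<open>J\<close>.\<close>

definition linear_ideal :: "('a, 'm) ring_scheme \<Rightarrow> 'a set \<Rightarrow> (nat \<Rightarrow> 'a) set" where
  "linear_ideal R J =
     {f \<in> carrier (UP R). coeff (UP R) f 0 = \<zero>\<^bsub>R\<^esub> \<and> coeff (UP R) f 1 \<in> J}"

context UP_cring
begin

text \<open>The convolution in the two degrees that survive modulo \<open>X^2\<close>; this rule and
  the next stand in for \<open>coeff_mult\<close> and its finite sums.\<close>

lemma coeff_mult_0:
  "f \<in> carrier P \<Longrightarrow> g \<in> carrier P \<Longrightarrow>
    coeff P (f \<otimes>\<^bsub>P\<^esub> g) 0 = coeff P f 0 \<otimes> coeff P g 0"
  by simp

lemma coeff_mult_1:
  "f \<in> carrier P \<Longrightarrow> g \<in> carrier P \<Longrightarrow>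
    coeff P (f \<otimes>\<^bsub>P\<^esub> g) (Suc 0) = coeff P f 0 \<otimes> coeff P g 1 \<oplus> coeff P f 1 \<otimes> coeff P g 0"
  by (simp add: R.a_comm)

lemma mem_linear_ideal_iff:
  "f \<in> linear_ideal R J \<longleftrightarrow> f \<in> carrier P \<and> coeff P f 0 = \<zero> \<and> coeff P f 1 \<in> J"
  by (simp add: linear_ideal_def P_def)

lemma linear_ideal_is_ideal:
  assumes "ideal J R"
  shows "ideal (linear_ideal R J) P"
proof (rule idealI)
  interpret J: ideal J R by fact
  show "subgroup (linear_ideal R J) (add_monoid P)"
  proof (rule P.add.subgroupI)
    have "\<zero>\<^bsub>P\<^esub> \<in> linear_ideal R J"
      by (simp add: mem_linear_ideal_iff)
    then show "linear_ideal R J \<noteq> {}" by blast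
  qed (auto simp: mem_linear_ideal_iff simp flip: a_inv_def)
  fix f g assume fg: "f \<in> linear_ideal R J" "g \<in> carrier P"
  then show "g \<otimes>\<^bsub>P\<^esub> f \<in> linear_ideal R J"
    by (simp add: mem_linear_ideal_iff coeff_mult_0 coeff_mult_1 J.I_l_closed del: coeff_mult)
  then show "f \<otimes>\<^bsub>P\<^esub> g \<in> linear_ideal R J"
    using fg P.m_comm by (simp add: mem_linear_ideal_iff)
qed (rule P.ring_axioms)

lemma minus_mem_linear_ideal_iff:
  assumes "f \<in> carrier P" "g \<in> carrier P"
  shows "f \<ominus>\<^bsub>P\<^esub> g \<in> linear_ideal R J \<longleftrightarrow>
    coeff P f 0 = coeff P g 0 \<and> coeff P f 1 \<ominus> coeff P g 1 \<in> J"
  using assms by (simp add: mem_linear_ideal_iff R.minus_eq P.minus_eq)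
    (metis R.minus_eq R.r_right_minus_eq coeff_closed)

lemma monom_add_pow:
  "a \<in> carrier R \<Longrightarrow> add_pow P (n::nat) (monom P a k) = monom P (add_pow R n a) k"
  by (induction n) simp_all

text \<open>Both generators satisfy the coefficient conditions. Conversely, the monomials of a
  member vanish in degree \<open>0\<close>, are multiples of \<open>p X\<close> in degree
  \<open>1\<close> and of \<open>X^2\<close> above.\<close>

lemma genideal_X_square_pX:
  "genideal P {monom P \<one> 1 [^]\<^bsub>P\<^esub> (2::nat), add_pow P (p::nat) (monom P \<one> 1)} =
    linear_ideal R (PIdl (add_pow R p \<one>))"
  (is "?I = linear_ideal R ?J")
proof
  let ?X = "monom P \<one> 1"
  have J: "ideal ?J R"
    by (rule R.cgenideal_ideal) simp
  have X2: "?X [^]\<^bsub>P\<^esub> (2::nat) = monom P \<one> 2"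
    using monom_pow[of \<one> 1 2] by simp
  have pX: "add_pow P p ?X = monom P (add_pow R p \<one>) 1"
    by (simp add: monom_add_pow)
  show "?I \<subseteq> linear_ideal R ?J"
  proof (rule P.genideal_minimal[OF linear_ideal_is_ideal[OF J]])
    show "{?X [^]\<^bsub>P\<^esub> (2::nat), add_pow P p ?X} \<subseteq> linear_ideal R ?J"
      unfolding X2 pX using R.cgenideal_self[of "add_pow R p \<one>"] J
      by (simp add: mem_linear_ideal_iff additive_subgroup.zero_closed ideal.axioms(1))
  qed
  have gens: "{?X [^]\<^bsub>P\<^esub> (2::nat), add_pow P p ?X} \<subseteq> carrier P"
    by simp
  interpret I: ideal ?I P
    by (rule P.genideal_ideal[OF gens])
  have I: "monom P \<one> 2 \<in> ?I" "monom P (add_pow R p \<one>) 1 \<in> ?I"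
    using P.genideal_self[OF gens] unfolding X2 pX by auto
  show "linear_ideal R ?J \<subseteq> ?I"
  proof
    fix f assume "f \<in> linear_ideal R ?J"
    then have f: "f \<in> carrier P" "coeff P f 0 = \<zero>" "coeff P f 1 \<in> ?J"
      by (simp_all add: mem_linear_ideal_iff)
    obtain r where r: "r \<in> carrier R" "coeff P f 1 = r \<otimes> add_pow R p \<one>"
      using f(3) by (auto simp: cgenideal_def)
    have "monom P (coeff P f i) i \<in> ?I" for i
    proof -
      consider "i = 0" | "i = 1" | k where "i = k + 2"
        by (metis One_nat_def Suc_1 add_2_eq_Suc' not0_implies_Suc)
      then show ?thesis
      proof cases
        case 1
        then show ?thesis
          using f(2) I.zero_closed by (simp del: One_nat_def)
      next
        case 2
        have "monom P (coeff P f 1) 1 = monom P r 0 \<otimes>\<^bsub>P\<^esub> monom P (add_pow R p \<one>) 1"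
          using r monom_mult[of r "add_pow R p \<one>" 0 1] by simp
        also have "\<dots> \<in> ?I"
          using r(1) I(2) by (intro I.I_l_closed) simp_all
        finally show ?thesis
          by (simp only: 2)
      next
        case 3
        have "monom P (coeff P f i) i = monom P (coeff P f i) k \<otimes>\<^bsub>P\<^esub> monom P \<one> 2"
          using f(1) 3 monom_mult[of "coeff P f i" \<one> k 2] by simp
        also have "\<dots> \<in> ?I"
          using f(1) I(1) by (intro I.I_l_closed) simp_all
        finally show ?thesis .
      qed
    qed
    then have "(\<Oplus>\<^bsub>P\<^esub>i\<in>{..deg R f}. monom P (coeff P f i) i) \<in> ?I"
      by (intro I.finsum_closed_in_ideal) auto
    then show "f \<in> ?I"
      using up_repr[OF f(1)] by simp
  qed
qed

text \<open>A coset is determined by its constant term and its linear coefficient modulo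
  \<open>J\<close>, and every such pair comes from some \<open>a + b X\<close>.\<close>

lemma order_Quot_linear_ideal:
  assumes "ideal J R"
  shows "order (P Quot linear_ideal R J) = order R * order (R Quot J)"
proof -
  interpret J: ideal J R by fact
  interpret K: ideal "linear_ideal R J" P
    by (rule linear_ideal_is_ideal[OF assms])
  have "order (P Quot linear_ideal R J) = card ((\<lambda>f. linear_ideal R J +>\<^bsub>P\<^esub> f) ` carrier P)"
    by (simp add: order_def FactRing_carrier)
  also have "\<dots> = card ((\<lambda>f. (coeff P f 0, J +> coeff P f 1)) ` carrier P)"
    by (rule card_image_eqI) (simp add: K.rcos_eq_iff J.rcos_eq_iff minus_mem_linear_ideal_iff)
  also have "(\<lambda>f. (coeff P f 0, J +> coeff P f 1)) ` carrier P = carrier R \<times> carrier (R Quot J)"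
  proof -
    have "(a, J +> b) \<in> (\<lambda>f. (coeff P f 0, J +> coeff P f 1)) ` carrier P"
      if "a \<in> carrier R" "b \<in> carrier R" for a b
      using that by (intro image_eqI[of _ _ "monom P a 0 \<oplus>\<^bsub>P\<^esub> monom P b 1"]) simp_all
    then show ?thesis
      by (auto simp: FactRing_carrier)
  qed
  finally show ?thesis
    by (simp add: order_def card_cartesian_product)
qed

text \<open>In the quotient, \<open>?M\<close> is the maximal ideal \<open>(t, X)\<close> and
  \<open>?N\<close> the ideal generated by \<open>t\<close>. The linear coefficient
  \<open>f0 g1 + f1 g0\<close> of a product from \<open>?M\<close> lies in \<open>(t)\<close>,
  whereas that of \<open>X\<close> is \<open>1\<close>.\<close>

lemma not_TAF_ring_Quot_linear_ideal:
  assumes t: "t \<in> carrier R" "t \<otimes> t \<otimes> t = \<zero>" "t \<otimes> t \<noteq> \<zero>"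
    and unit: "\<And>a. a \<in> carrier R \<Longrightarrow> a \<notin> PIdl t \<Longrightarrow> \<exists>u\<in>carrier R. u \<otimes> a = \<one>"
  shows "\<not> TAF_ring (P Quot linear_ideal R (PIdl t))"
proof -
  let ?J = "PIdl t"
  let ?K = "linear_ideal R ?J"
  let ?Q = "P Quot ?K"
  let ?q = "\<lambda>f. ?K +>\<^bsub>P\<^esub> f"
  interpret J: ideal ?J R
    by (rule R.cgenideal_ideal[OF t(1)])
  interpret K: ideal ?K P
    by (rule linear_ideal_is_ideal[OF J.is_ideal])
  interpret Q: cring ?Q
    by (rule K.quotient_is_cring[OF P.cring_axioms])
  interpret q: ring_hom_ring P ?Q ?q
    by (rule K.rcos_ring_hom_ring)
  have q_eq: "?q f = ?q g \<longleftrightarrow> coeff P f 0 = coeff P g 0 \<and> coeff P f 1 \<ominus> coeff P g 1 \<in> ?J"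
    if "f \<in> carrier P" "g \<in> carrier P" for f g
    using that by (simp add: K.rcos_eq_iff minus_mem_linear_ideal_iff)
  \<comment> \<open>Otherwise \<open>t\<close> would be a unit, and \<open>t^3 = 0\<close> would
    force \<open>t^2 = 0\<close>.\<close>
  have one: "\<one> \<notin> ?J"
  proof
    assume "\<one> \<in> ?J"
    then obtain r where r: "r \<in> carrier R" "\<one> = r \<otimes> t"
      unfolding cgenideal_def by blast
    have "t \<otimes> t = (r \<otimes> t) \<otimes> (t \<otimes> t)"
      using t(1) by (simp flip: r(2))
    also have "\<dots> = r \<otimes> (t \<otimes> t \<otimes> t)"
      using r(1) t(1) by (simp add: R.m_assoc)
    finally show False
      using r(1) t by simp
  qed
  let ?M = "?q ` {f \<in> carrier P. coeff P f 0 \<in> ?J}"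
  let ?N = "?q ` {f \<in> carrier P. coeff P f 0 \<in> ?J \<and> coeff P f 1 \<in> ?J}"
  let ?X = "monom P \<one> 1"
  let ?t = "monom P t 0"
  show ?thesis
  proof (rule Q.not_TAF_ringI[where x = "?q ?X" and t = "?q ?t" and M = ?M and N = ?N])
    have "?t \<otimes>\<^bsub>P\<^esub> ?t \<otimes>\<^bsub>P\<^esub> ?t = \<zero>\<^bsub>P\<^esub>"
      using t monom_mult[of t t 0 0] monom_mult[of "t \<otimes> t" t 0 0] by simp
    then have "?q (?t \<otimes>\<^bsub>P\<^esub> ?t \<otimes>\<^bsub>P\<^esub> ?t) = \<zero>\<^bsub>?Q\<^esub>"
      by (simp del: q.hom_mult)
    then show "?q ?t \<otimes>\<^bsub>?Q\<^esub> ?q ?t \<otimes>\<^bsub>?Q\<^esub> ?q ?t = \<zero>\<^bsub>?Q\<^esub>"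
      using t(1) by simp
    show "?q ?t \<otimes>\<^bsub>?Q\<^esub> ?q ?t \<notin> PIdl\<^bsub>?Q\<^esub> (?q ?X)"
    proof
      assume "?q ?t \<otimes>\<^bsub>?Q\<^esub> ?q ?t \<in> PIdl\<^bsub>?Q\<^esub> (?q ?X)"
      then obtain r where r: "r \<in> carrier P"
        "?q ?t \<otimes>\<^bsub>?Q\<^esub> ?q ?t = ?q r \<otimes>\<^bsub>?Q\<^esub> ?q ?X"
        unfolding cgenideal_def FactRing_carrier by blast
      then have "?q (?t \<otimes>\<^bsub>P\<^esub> ?t) = ?q (r \<otimes>\<^bsub>P\<^esub> ?X)"
        using t by simp
      \<comment> \<open>Constant terms are well defined in the quotient, and a multiple of
        \<open>X\<close> has constant term zero.\<close>
      then have "t \<otimes> t = coeff P r 0 \<otimes> \<zero>"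
        using r(1) t(1) by (subst (asm) q_eq) simp_all
      then show False
        using r(1) t by simp
    qed
    show "\<exists>b\<in>carrier ?Q. b \<otimes>\<^bsub>?Q\<^esub> a = \<one>\<^bsub>?Q\<^esub>" if a: "a \<in> carrier ?Q" "a \<notin> ?M" for a
    proof -
      obtain f where f: "f \<in> carrier P" "a = ?q f" "coeff P f 0 \<notin> ?J"
        using a by (auto simp: FactRing_carrier)
      then obtain u where u: "u \<in> carrier R" "u \<otimes> coeff P f 0 = \<one>"
        using unit coeff_closed by blast
      \<comment> \<open>With \<open>u\<close> inverse to \<open>f0\<close>, the inverse of
        \<open>f0 + f1 X\<close> modulo \<open>X^2\<close> is \<open>u - u^2 f1 X\<close>.\<close>
      let ?v = "u \<otimes> u \<otimes> coeff P f 1"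
      let ?g = "monom P u 0 \<ominus>\<^bsub>P\<^esub> monom P ?v 1"
      have v: "?v \<in> carrier R" "?v \<otimes> coeff P f 0 = u \<otimes> coeff P f 1"
      proof -
        show "?v \<in> carrier R" using f u by simp
        have "?v \<otimes> coeff P f 0 = u \<otimes> coeff P f 1 \<otimes> (u \<otimes> coeff P f 0)"
          using f(1) u(1) by (simp add: R.m_ac)
        then show "?v \<otimes> coeff P f 0 = u \<otimes> coeff P f 1"
          using f(1) u by simp
      qed
      have g: "?g \<in> carrier P" "coeff P ?g 0 = u" "coeff P ?g 1 = \<ominus> ?v"
        using u(1) v(1) by (simp_all add: P.minus_eq)
      have "coeff P (?g \<otimes>\<^bsub>P\<^esub> f) 0 = \<one>" "coeff P (?g \<otimes>\<^bsub>P\<^esub> f) 1 = \<zero>"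
        using f(1) g u v by (simp_all add: coeff_mult_0 coeff_mult_1 R.l_minus R.r_neg del: coeff_mult)
      then have "?q (?g \<otimes>\<^bsub>P\<^esub> f) = ?q \<one>\<^bsub>P\<^esub>"
        using f(1) g(1) by (subst q_eq) (simp_all add: R.minus_eq del: coeff_mult)
      then have "?q ?g \<otimes>\<^bsub>?Q\<^esub> a = \<one>\<^bsub>?Q\<^esub>"
        using f g(1) by simp
      then show ?thesis
        using g(1) q.hom_closed by blast
    qed
    show "a \<otimes>\<^bsub>?Q\<^esub> b \<in> ?N" if ab: "a \<in> ?M" "b \<in> ?M" for a b
    proof -
      obtain f g where fg: "f \<in> carrier P" "coeff P f 0 \<in> ?J" "a = ?q f"
        "g \<in> carrier P" "coeff P g 0 \<in> ?J" "b = ?q g"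
        using ab by auto
      then have "a \<otimes>\<^bsub>?Q\<^esub> b = ?q (f \<otimes>\<^bsub>P\<^esub> g)" by simp
      then show ?thesis
        using fg by (auto intro!: image_eqI[of _ _ "f \<otimes>\<^bsub>P\<^esub> g"]
          simp: coeff_mult_0 coeff_mult_1 J.I_l_closed J.I_r_closed simp del: coeff_mult)
    qed
    show "a \<oplus>\<^bsub>?Q\<^esub> b \<in> ?N" if ab: "a \<in> ?N" "b \<in> ?N" for a b
    proof -
      obtain f g where fg: "f \<in> carrier P" "coeff P f 0 \<in> ?J" "coeff P f 1 \<in> ?J" "a = ?q f"
        "g \<in> carrier P" "coeff P g 0 \<in> ?J" "coeff P g 1 \<in> ?J" "b = ?q g"
        using ab by auto
      then have "a \<oplus>\<^bsub>?Q\<^esub> b = ?q (f \<oplus>\<^bsub>P\<^esub> g)" by simp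
      then show ?thesis
        using fg by (auto intro!: image_eqI[of _ _ "f \<oplus>\<^bsub>P\<^esub> g"])
    qed
    show "?q ?X \<notin> ?N"
    proof
      assume "?q ?X \<in> ?N"
      then obtain f where f: "f \<in> carrier P" "coeff P f 1 \<in> ?J" "?q ?X = ?q f"
        by auto
      then have "\<one> \<ominus> coeff P f 1 \<in> ?J"
        by (subst (asm) q_eq) simp_all
      then have "(\<one> \<ominus> coeff P f 1) \<oplus> coeff P f 1 \<in> ?J"
        using f(2) by blast
      then show False
        using f(1) one by (simp add: R.minus_eq R.a_assoc R.l_neg)
    qed
  qed (use t(1) q.hom_closed in auto)
qed

end

section \<open>Residue rings of the integers\<close>

lemma ZMod_ring_hom: "ring_hom_ring \<Z> (ZFact n) (ZMod n)"
  using ideal.rcos_ring_hom_ring[OF int.genideal_ideal[of "{n}"]]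
  by (simp add: ZFact_def ZMod_def[abs_def])

lemma ZFact_carrier: "carrier (ZFact n) = range (ZMod n)"
  by (simp add: ZFact_def FactRing_carrier ZMod_def[abs_def])

lemma add_pow_one_ZFact: "add_pow (ZFact n) (k::nat) \<one>\<^bsub>ZFact n\<^esub> = ZMod n (int k)"
proof (induction k)
  interpret h: ring_hom_ring \<Z> "ZFact n" "ZMod n" by (rule ZMod_ring_hom)
  {
    case 0
    show ?case using h.hom_zero by simp
  next
    case (Suc k)
    then show ?case
      using h.hom_add[of "int k" 1] h.hom_one by (simp add: add.commute)
  }
qed

lemma order_ZFact: "n > 0 \<Longrightarrow> order (ZFact (int n)) = n"
  by (simp add: order_def ZFact_carrier card_range_mod ZMod_eq_mod)

text \<open>As \<open>p\<close> divides \<open>n\<close>, reduction modulo \<open>n\<close>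
  preserves divisibility by \<open>p\<close>.\<close>

lemma ZMod_mem_multiples_iff:
  assumes "int p dvd n"
  shows "ZMod n a \<in> PIdl\<^bsub>ZFact n\<^esub> (ZMod n (int p)) \<longleftrightarrow> int p dvd a"
proof -
  interpret h: ring_hom_ring \<Z> "ZFact n" "ZMod n" by (rule ZMod_ring_hom)
  have "ZMod n a \<in> PIdl\<^bsub>ZFact n\<^esub> (ZMod n (int p)) \<longleftrightarrow>
      (\<exists>r. ZMod n a = ZMod n r \<otimes>\<^bsub>ZFact n\<^esub> ZMod n (int p))"
    unfolding cgenideal_def ZFact_carrier by blast
  also have "\<dots> \<longleftrightarrow> (\<exists>r. a mod n = (r * int p) mod n)"
    using h.hom_mult by (simp add: ZMod_eq_mod flip: h.hom_mult)
  also have "\<dots> \<longleftrightarrow> int p dvd a"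
    using assms by (metis dvd_def dvd_mod_iff dvd_triv_right mult.commute)
  finally show ?thesis .
qed

text \<open>The cosets correspond to the residues modulo \<open>p\<close>, since
  \<open>ZMod n (a - b)\<close> lies in \<open>?J\<close> exactly when \<open>p\<close> divides
  \<open>a - b\<close>.\<close>

lemma order_ZFact_Quot_multiples:
  assumes "p > 0" "int p dvd n"
  shows "order (ZFact n Quot PIdl\<^bsub>ZFact n\<^esub> (ZMod n (int p))) = p"
proof -
  interpret h: ring_hom_ring \<Z> "ZFact n" "ZMod n" by (rule ZMod_ring_hom)
  interpret R: cring "ZFact n" by (rule ZFact_is_cring)
  let ?J = "PIdl\<^bsub>ZFact n\<^esub> (ZMod n (int p))"
  interpret J: ideal ?J "ZFact n"
    by (rule R.cgenideal_ideal) (simp add: ZFact_carrier)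
  have "?J +>\<^bsub>ZFact n\<^esub> ZMod n a = ?J +>\<^bsub>ZFact n\<^esub> ZMod n b \<longleftrightarrow> a mod int p = b mod int p" for a b
  proof -
    have "ZMod n a \<ominus>\<^bsub>ZFact n\<^esub> ZMod n b = ZMod n (a - b)"
      using h.hom_add[of a "- b"] h.hom_a_inv[of b] by (simp add: a_minus_def)
    then show ?thesis
      using assms(2)
      by (simp add: J.rcos_eq_iff ZFact_carrier ZMod_mem_multiples_iff mod_eq_dvd_iff)
  qed
  then have "card (range (\<lambda>a. ?J +>\<^bsub>ZFact n\<^esub> ZMod n a)) = p"
    using assms(1) by (intro card_range_mod)
  then show ?thesis
    by (simp add: order_def FactRing_carrier ZFact_carrier image_image)
qed

section \<open>The ring with \<open>p^4\<close> elements\<close>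

lemma example_ring_eq:
  "example_ring p = UP (ZFact (int p ^ 3)) Quot
    linear_ideal (ZFact (int p ^ 3)) (PIdl\<^bsub>ZFact (int p ^ 3)\<^esub> (ZMod (int p ^ 3) (int p)))"
proof -
  interpret UP_cring "ZFact (int p ^ 3)" "UP (ZFact (int p ^ 3))"
    by (simp_all add: UP_cring_def ZFact_is_cring)
  show ?thesis
    unfolding example_ring_def Let_def UP_X_def
    by (simp only: genideal_X_square_pX add_pow_one_ZFact)
qed

text \<open>Constant terms contribute \<open>p^3\<close> to the order and linear coefficients
  \<open>p\<close>. For the last claim \<open>t\<close> is the class of \<open>p\<close>: a class
  outside \<open>(p)\<close> is coprime to \<open>p^3\<close>, hence a unit.\<close>

lemma example_ring_properties:
  assumes p: "Factorial_Ring.prime p"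
  shows "cring (example_ring p)" "order (example_ring p) = p ^ 4" "\<not> TAF_ring (example_ring p)"
proof -
  let ?n = "int p ^ 3"
  let ?R = "ZFact ?n"
  let ?t = "ZMod ?n (int p)"
  interpret UP_cring ?R "UP ?R"
    by (simp_all add: UP_cring_def ZFact_is_cring)
  interpret h: ring_hom_ring \<Z> ?R "ZMod ?n" by (rule ZMod_ring_hom)
  have mult: "ZMod ?n a \<otimes>\<^bsub>?R\<^esub> ZMod ?n b = ZMod ?n (a * b)" for a b
    using h.hom_mult[of a b] by simp
  have zero: "\<zero>\<^bsub>?R\<^esub> = ZMod ?n 0" and one: "\<one>\<^bsub>?R\<^esub> = ZMod ?n 1"
    using h.hom_zero h.hom_one by simp_all
  have t: "?t \<in> carrier ?R"
    by (simp add: ZFact_carrier)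
  have J: "ideal (PIdl\<^bsub>?R\<^esub> ?t) ?R"
    by (rule R.cgenideal_ideal[OF t])
  have p0: "p > 0" and pn: "int p dvd ?n"
    using p prime_gt_0_nat by (simp_all add: dvd_power)
  show "cring (example_ring p)"
    unfolding example_ring_eq
    by (rule ideal.quotient_is_cring[OF linear_ideal_is_ideal[OF J] UP_cring])
  show "order (example_ring p) = p ^ 4"
    unfolding example_ring_eq order_Quot_linear_ideal[OF J] order_ZFact_Quot_multiples[OF p0 pn]
    using order_ZFact[of "p ^ 3"] p0 by (simp add: numeral_eq_Suc)
  have "int p > 1"
    using prime_gt_1_nat[OF p] by simp
  show "\<not> TAF_ring (example_ring p)"
    unfolding example_ring_eq
  proof (rule not_TAF_ring_Quot_linear_ideal[OF t])
    show "?t \<otimes>\<^bsub>?R\<^esub> ?t \<otimes>\<^bsub>?R\<^esub> ?t = \<zero>\<^bsub>?R\<^esub>"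
      unfolding mult zero by (simp add: ZMod_eq_mod power3_eq_cube)
    show "?t \<otimes>\<^bsub>?R\<^esub> ?t \<noteq> \<zero>\<^bsub>?R\<^esub>"
    proof -
      \<comment> \<open>Thus \<open>p^2\<close> is its own residue modulo \<open>p^3\<close>, and it
        is not zero.\<close>
      have "int p * int p < int p * int p * int p"
        using \<open>int p > 1\<close> by simp
      then show ?thesis
        unfolding mult zero using p0 by (simp add: ZMod_eq_mod power3_eq_cube)
    qed
    fix a assume "a \<in> carrier ?R" "a \<notin> PIdl\<^bsub>?R\<^esub> ?t"
    then obtain k where k: "a = ZMod ?n k" "\<not> int p dvd k"
      by (auto simp: ZFact_carrier ZMod_mem_multiples_iff[OF pn])
    then have "coprime (int p) k"
      using p by (intro prime_imp_coprime) simp_all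
    then have "coprime k ?n"
      by (simp add: coprime_commute)
    then obtain u where "[k * u = 1] (mod ?n)"
      using cong_solve_coprime_int by blast
    then have "ZMod ?n u \<otimes>\<^bsub>?R\<^esub> a = \<one>\<^bsub>?R\<^esub>"
      unfolding k(1) mult one ZMod_eq_mod cong_def by (simp only: mult.commute)
    then show "\<exists>u\<in>carrier ?R. u \<otimes>\<^bsub>?R\<^esub> a = \<one>\<^bsub>?R\<^esub>"
      by (auto simp: ZFact_carrier)
  qed
qed

theorem proposition2p6:
  shows "(\<forall>n::nat. n > 0 \<and> (\<forall>p::nat. Factorial_Ring.prime p \<longrightarrow> \<not> p ^ 4 dvd n) \<longrightarrow>
            (\<forall>R :: ('a, 'm) ring_scheme. cring R \<and> Coset.order R = n \<longrightarrow> TAF_ring R))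
       \<and> (\<forall>p::nat. Factorial_Ring.prime p \<longrightarrow>
            cring (example_ring p) \<and> Coset.order (example_ring p) = p ^ 4 \<and>
            \<not> TAF_ring (example_ring p))"
proof (intro conjI allI impI)
  fix n :: nat and R :: "('a, 'm) ring_scheme"
  assume n: "n > 0 \<and> (\<forall>p::nat. Factorial_Ring.prime p \<longrightarrow> \<not> p ^ 4 dvd n)"
    and R: "cring R \<and> order R = n"
  \<comment> \<open>An infinite carrier would have \<open>card\<close> equal to \<open>0\<close>, so
    positivity of the order yields finiteness.\<close>
  then have "card (carrier R) > 0"
    by (simp add: order_def)
  then have "finite (carrier R)"
    by (rule card_ge_0_finite)
  then show "TAF_ring R"
    using n R by (intro cring.fourth_power_free_order_imp_TAF_ring) auto
qed (simp_all add: example_ring_properties)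

end
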